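(* Given a data distribution $P$, under the assumption that $l(\cdot;z)$ is a convex, $L$-Lipschitz and $\beta$-smooth function for every $z\in\mathcal Z$, the gradient method with constant step-size $\eta\le\frac1\beta$ on the empirical risk $R_S$ with sample size $n$, which outputs $\hat\theta_T$ at iteration $T$, has the following uniform stability bound for all $T\ge1$: $$\mathcal E_{\mathrm{stab}}^{\mathrm{GD}}(\hat\theta_T,l,P,n)\le\frac{2\eta L^2T}{n}.$$
   Context: $\Omega\subset\mathbb R^d$ is the parameter space, $\mathcal Z$ the sample space, and $l(\theta;z)$ the loss for $\theta\in\Omega$, $z\in\mathcal Z$; for a sample $S=(z_1,\dots,z_n)$ drawn i.i.d. from $P$, the empirical risk is $R_S(\theta)=\frac1n\sum_{j=1}^n l(\theta;z_j)$. The gradient method (gradient descent, GD) on an objective $F$ starts at some initial point $\theta_0\in\Omega$ and iterates $\theta_{t+1}=\theta_t-\eta\nabla F(\theta_t)$, $t=0,1,2,\dots$, where $\eta$ is the step-size; here $F=R_S$ and $\hat\theta_T=\theta_T$. An algorithm with output $\hat\theta_S$ on sample $S$ is $\epsilon$-uniformly stable if for all $k\in\{1,\dots,n\}$ and all sample pairs $S=(z_1,\dots,z_k,\dots,z_n)$, $S'=(z_1,\dots,z_k',\dots,z_n)$, each $z_i$ or $z_k'$ sampled i.i.d. from $P$, one has $\sup_{z\in\mathcal Z}|l(\hat\theta_S;z)-l(\hat\theta_{S'};z)|\le\epsilon$; $\mathcal E_{\mathrm{stab}}(\hat\theta,l,P,n)$ denotes the uniform stability (the smallest such $\epsilon$).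 A function $f$ is $L$-Lipschitz if $|f(u)-f(v)|\le L\|u-v\|_2$; a continuously differentiable $f$ is $\beta$-smooth if $\|\nabla f(u)-\nabla f(v)\|_2\le\beta\|u-v\|_2$; $f$ is convex if $f(u)\ge f(v)+\langle\nabla f(v),u-v\rangle$; in each case for all $u,v\in\Omega$.
   Formalization: The parameter space Ω is assumed convex (the bound can fail for non-convex Ω), and the gradient method's iterates up to T are assumed to stay in Ω for every sample, so that it is well defined; also β>0 and η>0. *)

theory Defs
  imports "HOL-Probability.Probability"
begin

definition grad :: "('a::euclidean_space \<Rightarrow> real) \<Rightarrow> 'a \<Rightarrow> 'a" where
  "grad f x = (THE D. GDERIV f x :> D)"

lemma grad_eqI:
  assumes "GDERIV f x :> D"
  shows "grad f x = D"
  unfolding grad_def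
proof (rule the_equality)
  fix D' assume "GDERIV f x :> D'"
  then have "(\<lambda>h. h \<bullet> D') = (\<lambda>h. h \<bullet> D)"
    using assms unfolding gderiv_def by (rule has_derivative_unique)
  then show "D' = D"
    by (metis vector_eq_ldot)
qed (fact assms)

lemma differentiable_imp_GDERIV_grad:
  assumes "f differentiable (at x)"
  shows "GDERIV f x :> grad f x"
proof -
  obtain f' where f': "(f has_derivative f') (at x)"
    using assms unfolding differentiable_def by blast
  interpret linear f' using f' by (rule has_derivative_linear)
  have "f' = (\<lambda>h. h \<bullet> (\<Sum>b\<in>Basis. f' b *\<^sub>R b))"
  proof
    fix h
    have "f' h = f' (\<Sum>b\<in>Basis. (h \<bullet> b) *\<^sub>R b)" by (simp add: euclidean_representation)
    also have "\<dots> = h \<bullet> (\<Sum>b\<in>Basis. f' b *\<^sub>R b)"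
      by (simp add: sum scaleR inner_sum_right mult.commute)
    finally show "f' h = h \<bullet> (\<Sum>b\<in>Basis. f' b *\<^sub>R b)" .
  qed
  then have "GDERIV f x :> (\<Sum>b\<in>Basis. f' b *\<^sub>R b)"
    using f' unfolding gderiv_def by simp
  then show ?thesis by (simp add: grad_eqI)
qed

(* Differentiability is required at the points of Om in the ambient space, so that the
   gradient is unique also at boundary points. *)
definition C1_on :: "'a::euclidean_space set \<Rightarrow> ('a \<Rightarrow> real) \<Rightarrow> bool" where
  "C1_on Om f \<longleftrightarrow> (\<forall>x\<in>Om. f differentiable (at x)) \<and> continuous_on Om (grad f)"

definition smooth_with :: "real \<Rightarrow> 'a::euclidean_space set \<Rightarrow> ('a \<Rightarrow> real) \<Rightarrow> bool" where
  "smooth_with \<beta> Om f \<longleftrightarrow> C1_on Om f \<and>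
     (\<forall>u\<in>Om. \<forall>v\<in>Om. norm (grad f u - grad f v) \<le> \<beta> * norm (u - v))"

definition grad_convex_on :: "'a::euclidean_space set \<Rightarrow> ('a \<Rightarrow> real) \<Rightarrow> bool" where
  "grad_convex_on Om f \<longleftrightarrow> (\<forall>x\<in>Om. f differentiable (at x)) \<and>
     (\<forall>u\<in>Om. \<forall>v\<in>Om. f u \<ge> f v + grad f v \<bullet> (u - v))"

definition empirical_risk :: "('p \<Rightarrow> 'z \<Rightarrow> real) \<Rightarrow> nat \<Rightarrow> (nat \<Rightarrow> 'z) \<Rightarrow> 'p \<Rightarrow> real" where
  "empirical_risk l n S \<theta> = (1 / real n) * (\<Sum>j = 1..n. l \<theta> (S j))"

primrec gradient_descent ::
  "('a::euclidean_space \<Rightarrow> real) \<Rightarrow> real \<Rightarrow> 'a \<Rightarrow> nat \<Rightarrow> 'a" where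
  "gradient_descent F \<eta> \<theta>0 0 = \<theta>0"
| "gradient_descent F \<eta> \<theta>0 (Suc t) =
     gradient_descent F \<eta> \<theta>0 t - \<eta> *\<^sub>R grad F (gradient_descent F \<eta> \<theta>0 t)"

(* The sample space of P^n, i.e. the n-tuples (z_1,...,z_n) of points of space P,
   represented as extensional functions on the indices 1..n. *)
abbreviation samples :: "'z measure \<Rightarrow> nat \<Rightarrow> (nat \<Rightarrow> 'z) set" where
  "samples P n \<equiv> space (Pi\<^sub>M {1..n} (\<lambda>_. P))"

(* The supremum is taken in the extended reals: in the reals SUP is unspecified on
   unbounded sets. *)
definition uniformly_stable ::
  "((nat \<Rightarrow> 'z) \<Rightarrow> 'p) \<Rightarrow> ('p \<Rightarrow> 'z \<Rightarrow> real) \<Rightarrow> 'z measure \<Rightarrow> nat \<Rightarrow> real \<Rightarrow> bool" where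
  "uniformly_stable A l P n \<epsilon> \<longleftrightarrow>
     (\<forall>k\<in>{1..n}. \<forall>S\<in>samples P n. \<forall>z'\<in>space P.
        (SUP z\<in>space P. ereal \<bar>l (A S) z - l (A (S(k := z'))) z\<bar>) \<le> ereal \<epsilon>)"

(* Top if the algorithm is not uniformly stable for any epsilon. *)
definition E_stab ::
  "((nat \<Rightarrow> 'z) \<Rightarrow> 'p) \<Rightarrow> ('p \<Rightarrow> 'z \<Rightarrow> real) \<Rightarrow> 'z measure \<Rightarrow> nat \<Rightarrow> ereal" where
  "E_stab A l P n = Inf {ereal \<epsilon> |\<epsilon>. uniformly_stable A l P n \<epsilon>}"

(* The infimum is attained, so it is the smallest stability constant. *)
lemma E_stab_le_iff: "E_stab A l P n \<le> ereal \<epsilon> \<longleftrightarrow> uniformly_stable A l P n \<epsilon>"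
proof
  assume le: "E_stab A l P n \<le> ereal \<epsilon>"
  show "uniformly_stable A l P n \<epsilon>"
    unfolding uniformly_stable_def
  proof (intro ballI)
    fix k S z' assume "k \<in> {1..n}" "S \<in> samples P n" "z' \<in> space P"
    then have "(SUP z\<in>space P. ereal \<bar>l (A S) z - l (A (S(k := z'))) z\<bar>) \<le> E_stab A l P n"
      unfolding E_stab_def by (intro Inf_greatest) (auto simp: uniformly_stable_def)
    also note le
    finally show "(SUP z\<in>space P. ereal \<bar>l (A S) z - l (A (S(k := z'))) z\<bar>) \<le> ereal \<epsilon>" .
  qed
qed (auto simp: E_stab_def intro: Inf_lower)

end

theory Submission
  imports Defs
begin

text \<open>
  For one convex \<open>\<beta>\<close>-smooth loss the step \<open>x \<mapsto> x - \<eta> \<nabla>f x\<close> is nonexpansive, so exchanging one of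
  the \<open>n\<close> sample points increases the distance of the two trajectories by at most
  \<open>2 \<eta> L / n\<close> per iteration.

  Nonexpansiveness follows from cocoercivity of the gradient, whose proof evaluates the loss at an
  auxiliary point that may lie outside \<open>Om\<close>. Therefore cocoercivity is only used for nearby
  points of the relative interior; nonexpansiveness is then obtained by subdividing segments, and on
  all of \<open>Om\<close> by continuity. If \<open>Om\<close> has empty interior, gradients are replaced by their orthogonal
  projections onto the direction space of \<open>Om\<close>. This does not change the iteration, since
  the iterates stay in \<open>Om\<close>.
\<close>

section \<open>The direction space of the domain and orthogonal projection onto it\<close>

lemma convex_direction_space:
  fixes Om :: "'a::euclidean_space set"
  assumes "a \<in> Om"
  obtains V where "subspace V" "\<And>x y. x \<in> Om \<Longrightarrow> y \<in> Om \<Longrightarrow> x - y \<in> V"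
    "\<And>x. x \<in> rel_interior Om \<Longrightarrow> \<exists>e>0. \<forall>v\<in>V. norm v < e \<longrightarrow> x + v \<in> Om"
proof -
  \<comment> \<open>Translating the affine hull so that \<open>a\<close> becomes 0 gives a subspace.
    A point of the relative interior then has room in all directions of \<open>V\<close>, because a
    ball around it meets the affine hull only inside \<open>Om\<close>.\<close>
  define V where "V = (\<lambda>x. - a + x) ` (affine hull Om)"
  have aA: "a \<in> affine hull Om" using assms by (rule hull_inc)
  have sub: "subspace V"
    unfolding V_def by (intro affine_diffs_subspace affine_affine_hull aA)
  have diff: "x - y \<in> V" if "x \<in> Om" "y \<in> Om" for x y
  proof -
    have "- a + x \<in> V" "- a + y \<in> V" using that by (auto simp: V_def hull_inc)
    from subspace_diff[OF sub this] show ?thesis by simp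
  qed
  have "\<exists>e>0. \<forall>v\<in>V. norm v < e \<longrightarrow> x + v \<in> Om" if x: "x \<in> rel_interior Om" for x
  proof -
    obtain e where e: "e > 0" "ball x e \<inter> affine hull Om \<subseteq> Om" "x \<in> Om"
      using x unfolding mem_rel_interior_ball by blast
    have "x + v \<in> Om" if v: "v \<in> V" "norm v < e" for v
    proof -
      have "- a + x \<in> V" using e(3) by (auto simp: V_def hull_inc)
      from subspace_add[OF sub this v(1)] have "x + v \<in> affine hull Om"
        unfolding V_def by (auto simp: algebra_simps)
      moreover have "x + v \<in> ball x e" using v by (simp add: dist_norm)
      ultimately show ?thesis using e(2) by blast
    qed
    then show ?thesis using e(1) by blast
  qed
  with sub diff show ?thesis by (rule that)
qed

text \<open>The component in \<open>V\<close> of the orthogonal decomposition of \<open>x\<close>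
  serves as \<open>proj x\<close>: the remaining component is orthogonal to \<open>V\<close> and
  drops out of every inner product with a vector of \<open>V\<close>.\<close>

lemma orthogonal_projection_exists:
  fixes V :: "'a::euclidean_space set"
  assumes "subspace V"
  obtains proj where "\<And>x. proj x \<in> V" "\<And>x v. v \<in> V \<Longrightarrow> proj x \<bullet> v = x \<bullet> v"
proof -
  have "\<exists>y. y \<in> V \<and> (\<forall>v\<in>V. y \<bullet> v = x \<bullet> v)" for x
  proof -
    obtain y z where yz: "y \<in> span V" "\<And>w. w \<in> span V \<Longrightarrow> orthogonal z w" "x = y + z"
      using orthogonal_subspace_decomp_exists[of V x] by metis
    have sp: "span V = V" using assms by simp
    have "y \<bullet> v = x \<bullet> v" if "v \<in> V" for v
      using yz(2)[of v] that yz(3) sp by (simp add: orthogonal_def inner_add_left)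
    then show ?thesis using yz(1) sp by auto
  qed
  then show ?thesis using that by metis
qed

text \<open>Testing both hypotheses with the vector \<open>p - q\<close> of \<open>V\<close> itself
  turns its squared norm into an inner product with \<open>x - y\<close>, and Cauchy-Schwarz
  finishes. Through this, projected gradients inherit the Lipschitz constant \<beta>.\<close>

lemma norm_projection_diff_le:
  assumes "subspace V" "p \<in> V" "q \<in> V"
    and "\<And>v. v \<in> V \<Longrightarrow> p \<bullet> v = x \<bullet> v" "\<And>v. v \<in> V \<Longrightarrow> q \<bullet> v = y \<bullet> v"
  shows "norm (p - q) \<le> norm (x - y)"
proof -
  have "p - q \<in> V" using assms by (intro subspace_diff)
  then have "norm (p - q) * norm (p - q) = (x - y) \<bullet> (p - q)"
    using assms(4,5)[of "p - q"] by (metis inner_diff_left power2_eq_square power2_norm_eq_inner)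
  also have "\<dots> \<le> norm (x - y) * norm (p - q)" by (rule norm_cauchy_schwarz)
  finally show ?thesis
    by (cases "p - q = 0") auto
qed

section \<open>Cocoercivity and nonexpansiveness of a gradient step\<close>

text \<open>Only the first-order inequality and the Lipschitz bound on \<open>p\<close> enter, each
  evaluated at one auxiliary point per direction. This gives the constant \<open>2 * \<beta>\<close>
  instead of the classical \<beta>, which is still enough for step sizes up to
  \<open>1 / \<beta>\<close>.\<close>

lemma cocoercive:
  fixes f :: "'a::real_inner \<Rightarrow> real"
  assumes "\<beta> > 0"
    and "\<And>u v. u \<in> Om \<Longrightarrow> v \<in> Om \<Longrightarrow> f u \<ge> f v + p v \<bullet> (u - v)"
    and "\<And>u v. u \<in> Om \<Longrightarrow> v \<in> Om \<Longrightarrow> norm (p u - p v) \<le> \<beta> * norm (u - v)"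
    and "x \<in> Om" "y \<in> Om"
    and "y - (1 / (2 * \<beta>)) *\<^sub>R (p y - p x) \<in> Om" "x - (1 / (2 * \<beta>)) *\<^sub>R (p x - p y) \<in> Om"
  shows "(norm (p y - p x))\<^sup>2 \<le> 2 * \<beta> * ((p y - p x) \<bullet> (y - x))"
proof -
  \<comment> \<open>With a displacement of length factor \<open>s\<close>, the argument gains
    \<open>s * (1 - \<beta> * s)\<close> times the squared norm of the gradient difference. This
    choice of \<open>s\<close> maximizes the gain, whose coefficient becomes
    \<open>s / 2\<close>.\<close>
  define s where "s = 1 / (2 * \<beta>)"
  have s: "s > 0" "\<beta> * s = 1 / 2" using assms(1) by (auto simp: s_def)
  have half: "f y \<ge> f x + p x \<bullet> (y - x) + s / 2 * (norm (p y - p x))\<^sup>2"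
    if "x \<in> Om" "y \<in> Om" and w: "y - s *\<^sub>R (p y - p x) \<in> Om" for x y
  proof -
    define q where "q = p y - p x"
    \<comment> \<open>The point \<open>w\<close> links \<open>x\<close> and \<open>y\<close>: the
      tangent at \<open>x\<close> bounds \<open>f w\<close> from below, and the tangent at
      \<open>w\<close> bounds \<open>f y\<close> from below. The Lipschitz bound then replaces
      \<open>p w\<close> by \<open>p y\<close> at a cost of half the squared norm of
      \<open>q\<close>.\<close>
    define w where "w = y - s *\<^sub>R q"
    have wO: "w \<in> Om" using w by (simp add: w_def q_def)
    have 1: "f w \<ge> f x + p x \<bullet> (y - x) - s * (p x \<bullet> q)"
      using assms(2)[OF wO \<open>x \<in> Om\<close>] by (simp add: w_def inner_diff_right)
    have 2: "f y \<ge> f w + s * (p w \<bullet> q)"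
      using assms(2)[OF \<open>y \<in> Om\<close> wO] by (simp add: w_def)
    have "(p y - p w) \<bullet> q \<le> norm (p y - p w) * norm q" by (rule norm_cauchy_schwarz)
    also have "\<dots> \<le> (\<beta> * norm (y - w)) * norm q"
      by (intro mult_right_mono assms(3) \<open>y \<in> Om\<close> wO) simp
    also have "\<dots> = (\<beta> * s) * (norm q)\<^sup>2" using s by (simp add: w_def power2_eq_square)
    also have "\<dots> = (norm q)\<^sup>2 / 2" using s by simp
    finally have "p w \<bullet> q \<ge> p y \<bullet> q - (norm q)\<^sup>2 / 2" by (simp add: inner_diff_left)
    then have "s * (p w \<bullet> q) \<ge> s * (p y \<bullet> q - (norm q)\<^sup>2 / 2)"
      using s by (intro mult_left_mono) auto
    moreover have "p y \<bullet> q = p x \<bullet> q + (norm q)\<^sup>2"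
      by (simp add: power2_norm_eq_inner q_def inner_diff_left)
    ultimately have "s * (p w \<bullet> q) \<ge> s * (p x \<bullet> q) + s / 2 * (norm q)\<^sup>2"
      by (simp add: algebra_simps)
    with 1 2 show ?thesis by (simp add: q_def)
  qed
  have "f y \<ge> f x + p x \<bullet> (y - x) + s / 2 * (norm (p y - p x))\<^sup>2"
    using assms(4-6) by (intro half) (auto simp: s_def)
  moreover have "f x \<ge> f y + p y \<bullet> (x - y) + s / 2 * (norm (p x - p y))\<^sup>2"
    using assms(4,5,7) by (intro half) (auto simp: s_def)
  moreover have "p y \<bullet> (x - y) = - (p y \<bullet> (y - x))" by (simp add: inner_diff_right)
  ultimately have "s * (norm (p y - p x))\<^sup>2 \<le> (p y - p x) \<bullet> (y - x)"
    by (simp add: inner_diff_left norm_minus_commute[of "p x"])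
  then have "2 * \<beta> * (s * (norm (p y - p x))\<^sup>2) \<le> 2 * \<beta> * ((p y - p x) \<bullet> (y - x))"
    using assms(1) by (intro mult_left_mono) auto
  then show ?thesis using assms(1) by (simp add: s_def)
qed

text \<open>Expanding the square of the left side gives the square of \<open>norm d\<close>, minus
  \<open>2 * \<eta> * (q \<bullet> d)\<close>, plus \<eta> squared times the square of
  \<open>norm q\<close>; cocoercivity makes the last two terms nonpositive together.\<close>

lemma nonexpansive_step_if_cocoercive:
  fixes d q :: "'a::real_inner"
  assumes "(norm q)\<^sup>2 \<le> 2 * \<beta> * (q \<bullet> d)" "0 < \<beta>" "0 < \<eta>" "\<eta> \<le> 1 / \<beta>"
  shows "norm (d - \<eta> *\<^sub>R q) \<le> norm d"
proof (rule power2_le_imp_le)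
  have "\<eta> * (norm q)\<^sup>2 \<le> 1 / \<beta> * (norm q)\<^sup>2" using assms by (intro mult_right_mono) auto
  also have "\<dots> \<le> 2 * (q \<bullet> d)" using assms by (simp add: field_simps)
  finally have "\<eta> * (\<eta> * (norm q)\<^sup>2) \<le> \<eta> * (2 * (q \<bullet> d))"
    using assms by (intro mult_left_mono) auto
  then show "(norm (d - \<eta> *\<^sub>R q))\<^sup>2 \<le> (norm d)\<^sup>2"
    by (simp add: power2_norm_eq_inner inner_diff_left inner_diff_right inner_commute algebra_simps)
qed simp

text \<open>The segment is cut into equal pieces shorter than \<open>e\<close>. The increments of
  \<open>G\<close> over the pieces telescope, and the lengths of the pieces add up to the whole
  length.\<close>

lemma locally_nonexpansive_segment:
  fixes G :: "'a::real_normed_vector \<Rightarrow> 'b::real_normed_vector"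
  assumes "e > 0"
    and "\<And>x y. x \<in> closed_segment u v \<Longrightarrow> y \<in> closed_segment u v \<Longrightarrow> norm (y - x) < e
      \<Longrightarrow> norm (G y - G x) \<le> norm (y - x)"
  shows "norm (G v - G u) \<le> norm (v - u)"
proof -
  obtain m where m: "norm (v - u) / e < real m" using reals_Archimedean2 by blast
  then have m0: "real m > 0" using assms(1) by (meson divide_nonneg_pos le_less_trans norm_ge_zero)
  define X where "X i = u + (real i / real m) *\<^sub>R (v - u)" for i
  have X_seg: "X i \<in> closed_segment u v" if "i \<le> m" for i
    unfolding closed_segment_def X_def using that m0
    by (auto intro!: exI[of _ "real i / real m"] simp: algebra_simps)
  have X_diff: "X (Suc i) - X i = (1 / real m) *\<^sub>R (v - u)" for i
    by (simp add: X_def add_divide_distrib scaleR_left_distrib)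
  have step: "norm (G (X (Suc i)) - G (X i)) \<le> norm (v - u) / real m" if "i < m" for i
  proof -
    have n: "norm (X (Suc i) - X i) = norm (v - u) / real m" unfolding X_diff by simp
    also have "\<dots> < e" using m m0 assms(1) by (simp add: field_simps)
    finally show ?thesis using assms(2)[OF X_seg X_seg, of i "Suc i"] that n by simp
  qed
  have "G v - G u = G (X m) - G (X 0)" using m0 by (simp add: X_def)
  also have "\<dots> = (\<Sum>i<m. G (X (Suc i)) - G (X i))" using sum_lessThan_telescope[of "\<lambda>i. G (X i)" m] by simp
  also have "norm \<dots> \<le> (\<Sum>i<m. norm (v - u) / real m)"
    by (intro order_trans[OF norm_sum] sum_mono step) simp
  also have "\<dots> = norm (v - u)" using m0 by simp
  finally show ?thesis .
qed

text \<open>The relative interior of a convex set is dense in it, so inequalities between continuous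
  quantities pass from there to all of \<open>Om\<close>.\<close>

lemma rel_interior_sequence:
  fixes Om :: "'a::euclidean_space set"
  assumes "convex Om" "x \<in> Om"
  obtains X where "\<And>i. X i \<in> rel_interior Om" "X \<longlonglongrightarrow> x"
proof -
  have "x \<in> closure (rel_interior Om)"
    using assms convex_closure_rel_interior closure_subset by blast
  then show ?thesis using that unfolding closure_sequential by blast
qed

lemma nonexpansive_gradient_step:
  fixes f :: "'a::euclidean_space \<Rightarrow> real"
  assumes conv: "convex Om" and "subspace V"
    and ball: "\<And>x. x \<in> rel_interior Om \<Longrightarrow> \<exists>e>0. \<forall>v\<in>V. norm v < e \<longrightarrow> x + v \<in> Om"
    and pV: "\<And>x. x \<in> Om \<Longrightarrow> p x \<in> V"
    and f: "\<And>u v. u \<in> Om \<Longrightarrow> v \<in> Om \<Longrightarrow> f u \<ge> f v + p v \<bullet> (u - v)"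
    and p: "\<And>u v. u \<in> Om \<Longrightarrow> v \<in> Om \<Longrightarrow> norm (p u - p v) \<le> \<beta> * norm (u - v)"
    and \<beta>: "0 < \<beta>" and \<eta>: "0 < \<eta>" "\<eta> \<le> 1 / \<beta>"
    and uv: "u \<in> Om" "v \<in> Om"
  shows "norm ((v - \<eta> *\<^sub>R p v) - (u - \<eta> *\<^sub>R p u)) \<le> norm (v - u)"
proof -
  define G where "G x = x - \<eta> *\<^sub>R p x" for x
  have ri: "norm (G v - G u) \<le> norm (v - u)"
    if u: "u \<in> rel_interior Om" and v: "v \<in> rel_interior Om" for u v
  proof -
    obtain e1 where e1: "e1 > 0" "\<And>w. w \<in> V \<Longrightarrow> norm w < e1 \<Longrightarrow> u + w \<in> Om" using ball[OF u] by blast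
    obtain e2 where e2: "e2 > 0" "\<And>w. w \<in> V \<Longrightarrow> norm w < e2 \<Longrightarrow> v + w \<in> Om" using ball[OF v] by blast
    define e where "e = min e1 e2"
    have e: "e > 0" using e1 e2 by (simp add: e_def)
    \<comment> \<open>By convexity, equal neighbourhoods in the directions of \<open>V\<close> at
      the two endpoints sweep out a neighbourhood of the same radius along the whole
      segment.\<close>
    have tube: "x + w \<in> Om" if x: "x \<in> closed_segment u v" and w: "w \<in> V" "norm w < e" for x w
    proof -
      obtain t where t: "0 \<le> t" "t \<le> 1" "x = (1 - t) *\<^sub>R u + t *\<^sub>R v"
        using x unfolding closed_segment_def by blast
      have "(1 - t) *\<^sub>R (u + w) + t *\<^sub>R (v + w) \<in> Om"
        using t w e1(2) e2(2) by (intro convexD[OF conv]) (auto simp: e_def)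
      also have "(1 - t) *\<^sub>R (u + w) + t *\<^sub>R (v + w) = x + w"
        by (simp add: t algebra_simps)
      finally show ?thesis .
    qed
    have seg: "x \<in> Om" if "x \<in> closed_segment u v" for x
      using tube[OF that, of 0] subspace_0[OF \<open>subspace V\<close>] e by simp
    show ?thesis
    proof (rule locally_nonexpansive_segment[OF e])
      fix x y assume xy: "x \<in> closed_segment u v" "y \<in> closed_segment u v" "norm (y - x) < e"
      \<comment> \<open>The auxiliary points of \<open>cocoercive\<close> move by at most
        \<open>norm (b - a) / 2\<close>, as \<open>p\<close> is \<beta>-Lipschitz, and in a
        direction of \<open>V\<close>. Points closer than \<open>e\<close> therefore keep them
        inside the tube.\<close>
      have aux: "b - (1 / (2 * \<beta>)) *\<^sub>R (p b - p a) \<in> Om"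
        if a: "a \<in> closed_segment u v" and b: "b \<in> closed_segment u v" and ab: "norm (b - a) < e" for a b
      proof -
        define w where "w = (- (1 / (2 * \<beta>))) *\<^sub>R (p b - p a)"
        have "w \<in> V"
          unfolding w_def by (intro subspace_scale subspace_diff \<open>subspace V\<close> pV seg a b)
        moreover have "norm w = 1 / (2 * \<beta>) * norm (p b - p a)" using \<beta> by (simp add: w_def)
        moreover have "\<dots> \<le> 1 / (2 * \<beta>) * (\<beta> * norm (b - a))"
          using \<beta> by (intro mult_left_mono p seg a b) auto
        moreover have "\<dots> = norm (b - a) / 2" using \<beta> by simp
        ultimately have "b + w \<in> Om" using ab norm_ge_zero[of "b - a"] by (intro tube[OF b]) linarith+
        then show ?thesis by (simp add: w_def)
      qed
      have "(norm (p y - p x))\<^sup>2 \<le> 2 * \<beta> * ((p y - p x) \<bullet> (y - x))"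
        by (rule cocoercive[where f = f and Om = Om])
          (use \<beta> f p xy seg aux in \<open>auto simp: norm_minus_commute\<close>)
      from nonexpansive_step_if_cocoercive[OF this \<beta> \<eta>]
      show "norm (G y - G x) \<le> norm (y - x)" by (simp add: G_def algebra_simps)
    qed
  qed
  \<comment> \<open>The estimate extends to boundary points as a limit along relative interior
    sequences, since \<open>G\<close> is continuous on \<open>Om\<close>.\<close>
  have "\<beta>-lipschitz_on Om p" using p \<beta> by (intro lipschitz_onI) (auto simp: dist_norm)
  then have cont: "continuous_on Om G"
    unfolding G_def by (intro continuous_intros lipschitz_on_continuous_on)
  obtain X where X: "\<And>i. X i \<in> rel_interior Om" "X \<longlonglongrightarrow> u" using rel_interior_sequence[OF conv uv(1)] by blast
  obtain Y where Y: "\<And>i. Y i \<in> rel_interior Om" "Y \<longlonglongrightarrow> v" using rel_interior_sequence[OF conv uv(2)] by blast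
  have inO: "X i \<in> Om" "Y i \<in> Om" for i using X(1) Y(1) rel_interior_subset by blast+
  have "(\<lambda>i. G (X i)) \<longlonglongrightarrow> G u" "(\<lambda>i. G (Y i)) \<longlonglongrightarrow> G v"
    using cont X(2) Y(2) uv inO by (auto intro!: continuous_on_tendsto_compose[OF cont])
  then have "norm (G v - G u) \<le> norm (v - u)"
    using X Y ri by (intro LIMSEQ_le[of "\<lambda>i. norm (G (Y i) - G (X i))" _ "\<lambda>i. norm (Y i - X i)"] tendsto_intros) auto
  then show ?thesis by (simp add: G_def)
qed

section \<open>Norm bound for the projected gradient\<close>

text \<open>The Lipschitz condition on \<open>Om\<close> sees only directions in \<open>V\<close>,
  which is why \<open>p\<close> has to take values there. At a relative interior point, a short move
  along \<open>p x\<close> raises \<open>f\<close> at least at rate \<open>norm (p x)\<close> and at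
  most at rate \<open>L\<close> per unit length; continuity covers the other points.\<close>

lemma norm_gradient_le_lipschitz:
  fixes f :: "'a::euclidean_space \<Rightarrow> real"
  assumes conv: "convex Om" and "subspace V"
    and ball: "\<And>x. x \<in> rel_interior Om \<Longrightarrow> \<exists>e>0. \<forall>v\<in>V. norm v < e \<longrightarrow> x + v \<in> Om"
    and pV: "\<And>x. x \<in> Om \<Longrightarrow> p x \<in> V"
    and f: "\<And>u v. u \<in> Om \<Longrightarrow> v \<in> Om \<Longrightarrow> f u \<ge> f v + p v \<bullet> (u - v)"
    and cont: "continuous_on Om p"
    and lip: "L-lipschitz_on Om f"
    and x: "x \<in> Om"
  shows "norm (p x) \<le> L"
proof -
  have ri: "norm (p x) \<le> L" if x: "x \<in> rel_interior Om" for x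
  proof (cases "p x = 0")
    case True
    then show ?thesis using lipschitz_on_nonneg[OF lip] by simp
  next
    case False
    have xO: "x \<in> Om" using x rel_interior_subset by blast
    obtain e where e: "e > 0" "\<And>w. w \<in> V \<Longrightarrow> norm w < e \<Longrightarrow> x + w \<in> Om" using ball[OF x] by blast
    \<comment> \<open>The displacement \<open>s *\<^sub>R p x\<close> has norm \<open>e / 2\<close>,
      so it stays within the admissible radius.\<close>
    define s where "s = e / (2 * norm (p x))"
    have s: "s > 0" using e False by (simp add: s_def)
    have yO: "x + s *\<^sub>R p x \<in> Om"
      using e False s by (intro e(2) subspace_scale \<open>subspace V\<close> pV xO) (auto simp: s_def)
    have "s * (norm (p x))\<^sup>2 = p x \<bullet> ((x + s *\<^sub>R p x) - x)" by (simp add: power2_norm_eq_inner)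
    also have "\<dots> \<le> f (x + s *\<^sub>R p x) - f x" using f[OF yO xO] by simp
    also have "\<dots> \<le> dist (f (x + s *\<^sub>R p x)) (f x)" by (simp add: dist_real_def)
    also have "\<dots> \<le> L * dist (x + s *\<^sub>R p x) x" by (rule lipschitz_onD[OF lip yO xO])
    also have "\<dots> = s * (L * norm (p x))" using s by (simp add: dist_norm)
    finally show ?thesis using s False by (simp add: power2_eq_square)
  qed
  obtain X where X: "\<And>i. X i \<in> rel_interior Om" "X \<longlonglongrightarrow> x" using rel_interior_sequence[OF conv x] by blast
  have inO: "X i \<in> Om" for i using X(1) rel_interior_subset by blast
  have "(\<lambda>i. p (X i)) \<longlonglongrightarrow> p x"
    using X(2) x inO by (auto intro!: continuous_on_tendsto_compose[OF cont])
  then have "(\<lambda>i. norm (p (X i))) \<longlonglongrightarrow> norm (p x)" by (rule tendsto_norm)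
  then show ?thesis using ri X(1) by (intro LIMSEQ_le_const2) auto
qed

section \<open>Gradient steps on the empirical risk\<close>

lemma grad_empirical_risk:
  fixes l :: "'a::euclidean_space \<Rightarrow> 'z \<Rightarrow> real"
  assumes "\<And>j. j \<in> {1..n} \<Longrightarrow> (\<lambda>\<theta>. l \<theta> (S j)) differentiable (at x)"
  shows "grad (empirical_risk l n S) x = (1 / real n) *\<^sub>R (\<Sum>j = 1..n. grad (\<lambda>\<theta>. l \<theta> (S j)) x)"
proof (rule grad_eqI)
  have "((\<lambda>\<theta>. l \<theta> (S j)) has_derivative (\<lambda>h. h \<bullet> grad (\<lambda>\<theta>. l \<theta> (S j)) x)) (at x)" if "j \<in> {1..n}" for j
    using differentiable_imp_GDERIV_grad[OF assms[OF that]] by (simp add: gderiv_def)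
  then have "((\<lambda>\<theta>. (1 / real n) * (\<Sum>j = 1..n. l \<theta> (S j))) has_derivative
      (\<lambda>h. (1 / real n) * (\<Sum>j = 1..n. h \<bullet> grad (\<lambda>\<theta>. l \<theta> (S j)) x))) (at x)"
    by (intro has_derivative_mult_right has_derivative_sum)
  then show "GDERIV (empirical_risk l n S) x :> (1 / real n) *\<^sub>R (\<Sum>j = 1..n. grad (\<lambda>\<theta>. l \<theta> (S j)) x)"
    by (simp add: gderiv_def empirical_risk_def[abs_def] inner_sum_right)
qed

lemma subspace_eqI:
  assumes "subspace V" "x \<in> V" "y \<in> V" "\<And>v. v \<in> V \<Longrightarrow> x \<bullet> v = y \<bullet> v"
  shows "x = y"
proof -
  have "(x - y) \<bullet> (x - y) = 0"
    using assms(4)[OF subspace_diff[OF assms(1-3)]] by (simp add: inner_diff_left)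
  then show ?thesis by simp
qed

text \<open>A step along an averaged direction is the average of the individual steps. The excess
  \<open>c\<close> occurs in one summand only and is divided by \<open>n\<close>; this is the source
  of the factor \<open>1 / n\<close> in the stability bound.\<close>

lemma norm_mean_step_diff_le:
  fixes a b :: "nat \<Rightarrow> 'a::real_normed_vector"
  assumes "k \<in> {1..n}"
    and "\<And>j. j \<in> {1..n} \<Longrightarrow> norm ((x - \<eta> *\<^sub>R a j) - (y - \<eta> *\<^sub>R b j)) \<le> norm (x - y) + (if j = k then c else 0)"
  shows "norm ((x - \<eta> *\<^sub>R ((1 / real n) *\<^sub>R (\<Sum>j=1..n. a j))) - (y - \<eta> *\<^sub>R ((1 / real n) *\<^sub>R (\<Sum>j=1..n. b j))))
    \<le> norm (x - y) + c / real n"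
proof -
  have n: "real n > 0" using assms(1) by auto
  have mean: "z - \<eta> *\<^sub>R ((1 / real n) *\<^sub>R (\<Sum>j=1..n. g j)) = (1 / real n) *\<^sub>R (\<Sum>j=1..n. z - \<eta> *\<^sub>R g j)"
    for z and g :: "nat \<Rightarrow> 'a"
    using n by (simp add: sum_subtractf scaleR_right_diff_distrib scaleR_sum_right sum_constant_scaleR)
  have "norm (\<Sum>j=1..n. (x - \<eta> *\<^sub>R a j) - (y - \<eta> *\<^sub>R b j)) \<le> (\<Sum>j=1..n. norm (x - y) + (if j = k then c else 0))"
    by (intro order_trans[OF norm_sum] sum_mono assms(2))
  also have "\<dots> = real n * norm (x - y) + c" using assms(1) by (simp add: sum.distrib)
  finally have "(1 / real n) * norm (\<Sum>j=1..n. (x - \<eta> *\<^sub>R a j) - (y - \<eta> *\<^sub>R b j))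
      \<le> (1 / real n) * (real n * norm (x - y) + c)"
    by (intro mult_left_mono) auto
  moreover have "(x - \<eta> *\<^sub>R ((1 / real n) *\<^sub>R (\<Sum>j=1..n. a j))) - (y - \<eta> *\<^sub>R ((1 / real n) *\<^sub>R (\<Sum>j=1..n. b j)))
      = (1 / real n) *\<^sub>R (\<Sum>j=1..n. (x - \<eta> *\<^sub>R a j) - (y - \<eta> *\<^sub>R b j))"
    unfolding mean by (simp only: sum_subtractf scaleR_right_diff_distrib)
  ultimately show ?thesis using n by (simp add: field_simps)
qed

section \<open>Divergence of two trajectories and the resulting stability bound\<close>

theorem theorem10:
  fixes Om :: "(real ^ 'd) set"
    and P :: "'z measure"
    and l :: "real ^ 'd \<Rightarrow> 'z \<Rightarrow> real"
    and L \<beta> \<eta> :: real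
    and \<theta>0 :: "real ^ 'd"
    and n T :: nat
  assumes "prob_space P"
    and "convex Om"
    and "\<And>z. z \<in> space P \<Longrightarrow> grad_convex_on Om (\<lambda>\<theta>. l \<theta> z)"
    and "\<And>z. z \<in> space P \<Longrightarrow> L-lipschitz_on Om (\<lambda>\<theta>. l \<theta> z)"
    and "\<And>z. z \<in> space P \<Longrightarrow> smooth_with \<beta> Om (\<lambda>\<theta>. l \<theta> z)"
    and "0 < \<beta>" and "0 < \<eta>" and "\<eta> \<le> 1 / \<beta>"
    and "n \<ge> 1" and "T \<ge> 1"
    and "\<theta>0 \<in> Om"
    and "\<And>S t. S \<in> samples P n \<Longrightarrow> t \<le> T \<Longrightarrow>
           gradient_descent (empirical_risk l n S) \<eta> \<theta>0 t \<in> Om"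
  shows "E_stab (\<lambda>S. gradient_descent (empirical_risk l n S) \<eta> \<theta>0 T) l P n
           \<le> ereal (2 * \<eta> * L\<^sup>2 * real T / real n)"
proof -
  obtain V where V: "subspace V" "\<And>x y. x \<in> Om \<Longrightarrow> y \<in> Om \<Longrightarrow> x - y \<in> V"
    and ball: "\<And>x. x \<in> rel_interior Om \<Longrightarrow> \<exists>e>0. \<forall>v\<in>V. norm v < e \<longrightarrow> x + v \<in> Om"
    using convex_direction_space[OF \<open>\<theta>0 \<in> Om\<close>] by blast
  obtain proj :: "real ^ 'd \<Rightarrow> real ^ 'd" where proj: "\<And>x. proj x \<in> V"
      "\<And>x v. v \<in> V \<Longrightarrow> proj x \<bullet> v = x \<bullet> v"
    using orthogonal_projection_exists[OF V(1)] by blast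
  define p where "p z x = proj (grad (\<lambda>\<theta>. l \<theta> z) x)" for z x
  have pV: "p z x \<in> V" for z x by (simp add: p_def proj)
  \<comment> \<open>Projecting the gradient keeps the first-order inequality, because
    \<open>u - v\<close> lies in \<open>V\<close>.\<close>
  have f: "l u z \<ge> l v z + p z v \<bullet> (u - v)" if "z \<in> space P" "u \<in> Om" "v \<in> Om" for z u v
    using assms(3)[OF that(1)] that V(2) by (auto simp: grad_convex_on_def p_def proj)
  have p: "norm (p z u - p z v) \<le> \<beta> * norm (u - v)" if "z \<in> space P" "u \<in> Om" "v \<in> Om" for z u v
  proof -
    have "norm (p z u - p z v) \<le> norm (grad (\<lambda>\<theta>. l \<theta> z) u - grad (\<lambda>\<theta>. l \<theta> z) v)"
      unfolding p_def by (rule norm_projection_diff_le[OF V(1)]) (auto simp: proj)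
    also have "\<dots> \<le> \<beta> * norm (u - v)" using assms(5)[OF that(1)] that by (auto simp: smooth_with_def)
    finally show ?thesis .
  qed
  have nonexp: "norm ((v - \<eta> *\<^sub>R p z v) - (u - \<eta> *\<^sub>R p z u)) \<le> norm (v - u)"
    if "z \<in> space P" "u \<in> Om" "v \<in> Om" for z u v
    by (rule nonexpansive_gradient_step[where f = "\<lambda>\<theta>. l \<theta> z" and V = V and Om = Om and \<beta> = \<beta>])
      (use assms V ball pV f p that in auto)
  have bound: "norm (p z x) \<le> L" if "z \<in> space P" "x \<in> Om" for z x
  proof -
    have "\<beta>-lipschitz_on Om (p z)"
      using p that \<open>0 < \<beta>\<close> by (intro lipschitz_onI) (auto simp: dist_norm)
    then show ?thesis
      by (intro norm_gradient_le_lipschitz[where f = "\<lambda>\<theta>. l \<theta> z" and V = V and Om = Om])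
        (use assms V ball pV f that lipschitz_on_continuous_on in auto)
  qed
  let ?A = "\<lambda>S t. gradient_descent (empirical_risk l n S) \<eta> \<theta>0 t"
  have step: "?A S (Suc t) = ?A S t - \<eta> *\<^sub>R ((1 / real n) *\<^sub>R (\<Sum>j=1..n. p (S j) (?A S t)))"
    if S: "S \<in> samples P n" and t: "t < T" for S t
  proof -
    have SP: "S j \<in> space P" if "j \<in> {1..n}" for j using S that by (auto simp: space_PiM)
    let ?g = "grad (empirical_risk l n S) (?A S t)"
    have in1: "?A S t \<in> Om" and in2: "?A S (Suc t) \<in> Om" using assms(12)[OF S] t by (auto simp del: gradient_descent.simps)
    have g: "?g = (1 / real n) *\<^sub>R (\<Sum>j = 1..n. grad (\<lambda>\<theta>. l \<theta> (S j)) (?A S t))"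
      using assms(3) SP in1 by (intro grad_empirical_risk) (auto simp: grad_convex_on_def)
    \<comment> \<open>The gradient of the empirical risk at an iterate is a multiple of the
      difference of two consecutive iterates in \<open>Om\<close>, hence lies in \<open>V\<close>.
      It thus equals its own projection, which is the mean of the projected gradients of the losses.
      The bound \<open>t < T\<close> ensures that iterate \<open>Suc t\<close> is still known to lie
      in \<open>Om\<close>.\<close>
    have "(1 / \<eta>) *\<^sub>R (?A S t - ?A S (Suc t)) \<in> V" by (intro subspace_scale V in1 in2)
    then have gV: "?g \<in> V" using \<open>0 < \<eta>\<close> by simp
    have "?g = (1 / real n) *\<^sub>R (\<Sum>j=1..n. p (S j) (?A S t))"
    proof (rule subspace_eqI[OF V(1) gV])
      show "(1 / real n) *\<^sub>R (\<Sum>j=1..n. p (S j) (?A S t)) \<in> V"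
        by (intro subspace_scale subspace_sum V(1) pV)
    qed (simp add: g inner_sum_left p_def proj)
    then show ?thesis by simp
  qed
  have "uniformly_stable (\<lambda>S. ?A S T) l P n (2 * \<eta> * L\<^sup>2 * real T / real n)"
    unfolding uniformly_stable_def
  proof (intro ballI SUP_least)
    fix k S z' z assume k: "k \<in> {1..n}" and S: "S \<in> samples P n" and z': "z' \<in> space P" and z: "z \<in> space P"
    define S' where "S' = S(k := z')"
    have S': "S' \<in> samples P n" using S k z' by (auto simp: S'_def space_PiM PiE_def extensional_def)
    have SP: "S j \<in> space P" "S' j \<in> space P" if "j \<in> {1..n}" for j using S S' that by (auto simp: space_PiM)
    \<comment> \<open>Both runs start at \<open>\<theta>0\<close>, and each iteration adds at most
      \<open>2 * \<eta> * L / n\<close> to their distance.\<close>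
    have dist: "norm (?A S t - ?A S' t) \<le> real t * (2 * \<eta> * L / real n)" if "t \<le> T" for t
      using that
    proof (induction t)
      case (Suc t)
      let ?x = "?A S t" and ?y = "?A S' t"
      have xy: "?x \<in> Om" "?y \<in> Om" using assms(12) S S' Suc.prems by auto
      \<comment> \<open>For \<open>j\<close> different from \<open>k\<close> both runs use the same
        loss, and its step is nonexpansive. At \<open>k\<close> the losses may be unrelated, so the
        triangle inequality is used, with each of the two gradient displacements bounded by
        \<open>\<eta> * L\<close>.\<close>
      have single: "norm ((?x - \<eta> *\<^sub>R p (S j) ?x) - (?y - \<eta> *\<^sub>R p (S' j) ?y))
          \<le> norm (?x - ?y) + (if j = k then 2 * \<eta> * L else 0)" if j: "j \<in> {1..n}" for j
      proof (cases "j = k")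
        case False
        then have "S' j = S j" by (simp add: S'_def)
        then show ?thesis using False nonexp[OF SP(1)[OF j] xy(2,1)] by simp
      next
        case True
        have "norm ((?x - \<eta> *\<^sub>R p (S j) ?x) - (?y - \<eta> *\<^sub>R p (S' j) ?y))
            = norm ((?x - ?y) + (\<eta> *\<^sub>R p (S' j) ?y - \<eta> *\<^sub>R p (S j) ?x))"
          by (simp add: algebra_simps)
        also have "\<dots> \<le> norm (?x - ?y) + (norm (\<eta> *\<^sub>R p (S' j) ?y) + norm (\<eta> *\<^sub>R p (S j) ?x))"
          by (intro order_trans[OF norm_triangle_ineq] add_left_mono norm_triangle_ineq4)
        also have "\<dots> \<le> norm (?x - ?y) + (\<eta> * L + \<eta> * L)"
          using \<open>0 < \<eta>\<close> bound[OF SP(2)[OF j] xy(2)] bound[OF SP(1)[OF j] xy(1)]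
          by (intro add_left_mono add_mono) (auto intro: mult_left_mono)
        finally show ?thesis using True by (simp add: mult.commute)
      qed
      have "norm (?A S (Suc t) - ?A S' (Suc t)) \<le> norm (?x - ?y) + 2 * \<eta> * L / real n"
        using norm_mean_step_diff_le[OF k single] step[OF S] step[OF S'] Suc.prems
        by (simp del: gradient_descent.simps)
      also have "norm (?x - ?y) \<le> real t * (2 * \<eta> * L / real n)" using Suc by simp
      finally show ?case by (simp add: algebra_simps add_divide_distrib del: gradient_descent.simps)
    qed simp
    have L: "L \<ge> 0" using lipschitz_on_nonneg[OF assms(4)[OF z]] .
    \<comment> \<open>Lipschitz continuity of the loss turns the distance of the outputs into a
      difference of losses and contributes the second factor \<open>L\<close>.\<close>
    have "\<bar>l (?A S T) z - l (?A S' T) z\<bar> \<le> L * norm (?A S T - ?A S' T)"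
      using lipschitz_onD[OF assms(4)[OF z]] assms(12)[OF S] assms(12)[OF S']
      by (simp add: dist_norm)
    also have "\<dots> \<le> L * (real T * (2 * \<eta> * L / real n))" using L dist by (intro mult_left_mono) auto
    also have "\<dots> = 2 * \<eta> * L\<^sup>2 * real T / real n" by (simp add: power2_eq_square)
    finally show "ereal \<bar>l (?A S T) z - l (?A (S(k := z')) T) z\<bar> \<le> ereal (2 * \<eta> * L\<^sup>2 * real T / real n)"
      by (simp add: S'_def)
  qed
  then show ?thesis by (simp add: E_stab_le_iff)
qed

end
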